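(* Let $m \geq 1$, $\alpha \in \mathbb{R}$ and $\mathbf{x} \in \mathbb{R}^m$. For $t \geq 0$ let $I_t = \{k \in \{1,\ldots,m\} : |\mathbf{x}_k| \geq t\}$ and define $\psi : [0,\infty) \to \mathbb{R}$ by $$\psi(t) = \frac{1}{2}\sum_{k=1}^m (\sigma_t(\mathbf{x}_k) - \mathbf{x}_k)^2 + \alpha t = \frac{1}{2}\sum_{k \in I_t} (|\mathbf{x}_k| - t)^2 + \alpha t.$$ Let $\mathbf{s}$ be a permutation of $|\mathbf{x}| = (|\mathbf{x}_1|,\ldots,|\mathbf{x}_m|)$ with $\mathbf{s}_1 \geq \mathbf{s}_2 \geq \cdots \geq \mathbf{s}_m \geq 0$, and set $\mathbf{s}_{m+1} = 0$. Then: (1) $\psi$ is $\mathcal{C}^1$ on $t > 0$; (2) $\psi$ is strictly convex on $0 \leq t \leq \|\mathbf{x}\|_\infty = \mathbf{s}_1$; (3) if $\tau = \arg\min_{t \geq 0} \psi(t)$ (the smallest minimizer, if there is more than one), then $\tau \leq \|\mathbf{x}\|_\infty = \mathbf{s}_1$; (4) for $\tau$ as in (3), $\tau = 0$ if and only if $\|\mathbf{x}\|_1 \leq \alpha$.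
   Context: For $t \geq 0$, the function $\sigma_t : \mathbb{R} \to \mathbb{R}$ is defined by $\sigma_t(u) = t$ if $u \geq t$, $\sigma_t(u) = u$ if $|u| < t$, and $\sigma_t(u) = -t$ if $u \leq -t$. Statements (3) and (4) concern only the case in which a minimizer of $\psi$ over $[0,\infty)$ exists. *)

theory Defs
  imports "HOL-Analysis.Analysis"
begin

(* Only used for t >= 0, where the last branch is the case u <= -t. *)
definition sigma :: "real \<Rightarrow> real \<Rightarrow> real" where
  "sigma t u = (if u \<ge> t then t else if \<bar>u\<bar> < t then u else - t)"

definition large_idx :: "real ^ 'n::finite \<Rightarrow> real \<Rightarrow> 'n set" where
  "large_idx x t = {k. \<bar>x $ k\<bar> \<ge> t}"

(* The mathematical domain is t >= 0; values at negative t carry no meaning. *)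
definition psi :: "real \<Rightarrow> real ^ 'n::finite \<Rightarrow> real \<Rightarrow> real" where
  "psi \<alpha> x t = 1 / 2 * (\<Sum>k\<in>UNIV. (sigma t (x $ k) - x $ k)\<^sup>2) + \<alpha> * t"

definition l1_norm :: "real ^ 'n::finite \<Rightarrow> real" where
  "l1_norm x = (\<Sum>k\<in>UNIV. \<bar>x $ k\<bar>)"

definition strictly_convex_on :: "'a::real_vector set \<Rightarrow> ('a \<Rightarrow> real) \<Rightarrow> bool" where
  "strictly_convex_on S f \<longleftrightarrow> convex S \<and>
     (\<forall>a\<in>S. \<forall>b\<in>S. \<forall>u v. a \<noteq> b \<longrightarrow> 0 < u \<longrightarrow> 0 < v \<longrightarrow> u + v = 1 \<longrightarrow>
        f (u *\<^sub>R a + v *\<^sub>R b) < u * f a + v * f b)"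

(* A relation rather than a function: it holds of no point if f has no smallest
   minimizer on the set of points satisfying P. *)
definition is_smallest_minimizer :: "(real \<Rightarrow> real) \<Rightarrow> (real \<Rightarrow> bool) \<Rightarrow> real \<Rightarrow> bool" where
  "is_smallest_minimizer f P \<tau> \<longleftrightarrow>
     is_arg_min f P \<tau> \<and> (\<forall>t. is_arg_min f P t \<longrightarrow> \<tau> \<le> t)"

end

theory Submission
  imports Defs
begin

text \<open>
  For \<open>t \<ge> 0\<close> every coordinate contributes \<open>(max 0 (\<bar>x\<^sub>k\<bar> - t))\<^sup>2\<close>, which is convex and
  continuously differentiable in \<open>t\<close>. A coordinate of maximal modulus contributes
  \<open>(\<parallel>x\<parallel>\<^sub>\<infinity> - t)\<^sup>2\<close> on \<open>[0, \<parallel>x\<parallel>\<^sub>\<infinity>]\<close>, whence strict convexity there. Beyond \<open>\<parallel>x\<parallel>\<^sub>\<infinity>\<close> the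
  function is \<open>\<alpha> t\<close>, so a minimizer lying there forces \<open>\<alpha> = 0\<close> and then \<open>\<parallel>x\<parallel>\<^sub>\<infinity>\<close> is a smaller
  one. Finally \<open>\<psi>(t) - \<psi>(0)\<close> lies between \<open>(\<alpha> - \<parallel>x\<parallel>\<^sub>1) t\<close> and
  \<open>(\<alpha> - \<parallel>x\<parallel>\<^sub>1) t + m t\<^sup>2 / 2\<close>, which decides whether \<open>0\<close> is a minimizer.
\<close>

section \<open>Closed forms of the objective for nonnegative \<open>t\<close>\<close>

lemma sigma_diff_square:
  assumes "t \<ge> 0"
  shows "(sigma t u - u)\<^sup>2 = (max 0 (\<bar>u\<bar> - t))\<^sup>2"
proof -
  \<comment> \<open>\<open>sigma t\<close> is the nearest-point projection onto the interval from
    \<open>-t\<close> to \<open>t\<close>, so the distance it moves \<open>u\<close> is the excess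
    of the modulus over \<open>t\<close>.\<close>
  have "\<bar>sigma t u - u\<bar> = max 0 (\<bar>u\<bar> - t)"
    using assms by (auto simp: sigma_def)
  then show ?thesis by (metis power2_abs)
qed

lemma psi_eq_sum_max:
  assumes "t \<ge> 0"
  shows "psi \<alpha> x t = 1 / 2 * (\<Sum>k\<in>UNIV. (max 0 (\<bar>x $ k\<bar> - t))\<^sup>2) + \<alpha> * t"
  by (simp add: psi_def sigma_diff_square[OF assms])

lemma psi_eq_sum_large_idx:
  assumes "t \<ge> 0"
  shows "psi \<alpha> x t = 1 / 2 * (\<Sum>k\<in>large_idx x t. (\<bar>x $ k\<bar> - t)\<^sup>2) + \<alpha> * t"
proof -
  have "(\<Sum>k\<in>UNIV. (max 0 (\<bar>x $ k\<bar> - t))\<^sup>2) = (\<Sum>k\<in>large_idx x t. (\<bar>x $ k\<bar> - t)\<^sup>2)"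
    by (rule sum.mono_neutral_cong_right) (auto simp: large_idx_def max_def)
  then show ?thesis by (simp add: psi_eq_sum_max[OF assms])
qed

section \<open>Continuous differentiability\<close>

lemma has_real_derivative_max_square:
  fixes c t :: real
  shows "((\<lambda>t. (max 0 (c - t))\<^sup>2) has_real_derivative - 2 * max 0 (c - t)) (at t)"
proof -
  consider "t < c" | "t > c" | "t = c" by linarith
  then show ?thesis
  proof cases
    case 1
    have "((\<lambda>t. (c - t)\<^sup>2) has_real_derivative - 2 * max 0 (c - t)) (at t)"
      using 1 by (auto intro!: derivative_eq_intros)
    then show ?thesis
      by (rule has_field_derivative_transform_within_open[where S = "{..<c}"]) (use 1 in auto)
  next
    case 2
    have "((\<lambda>t. 0) has_real_derivative - 2 * max 0 (c - t)) (at t)"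
      using 2 by simp
    then show ?thesis
      by (rule has_field_derivative_transform_within_open[where S = "{c<..}"]) (use 2 in auto)
  next
    case 3
    \<comment> \<open>At the kink \<open>t = c\<close> this is the difference quotient itself. It is
      at most \<open>\<bar>h\<bar>\<close> in modulus, so squaring smooths out the corner of
      \<open>max\<close>.\<close>
    have "((\<lambda>h::real. (max 0 (- h))\<^sup>2 / h) \<longlongrightarrow> 0) (at 0)"
    proof (rule Lim_null_comparison)
      have "(max 0 (- h))\<^sup>2 \<le> \<bar>h\<bar> * \<bar>h\<bar>" for h :: real
        by (auto simp: max_def power2_eq_square)
      then show "\<forall>\<^sub>F h in at 0. norm ((max 0 (- h))\<^sup>2 / h) \<le> \<bar>h\<bar>"
        by (auto simp: eventually_at_filter divide_simps abs_divide)
      show "(abs \<longlongrightarrow> 0) (at (0::real))"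
        by (rule tendsto_rabs_zero) simp
    qed
    then show ?thesis
      using 3 by (simp add: DERIV_def)
  qed
qed

lemma C1_differentiable_on_psi: "psi \<alpha> x C1_differentiable_on {0<..}"
proof -
  define D where "D t = 1 / 2 * (\<Sum>k\<in>UNIV. - 2 * max 0 (\<bar>x $ k\<bar> - t)) + \<alpha>" for t
  have "(psi \<alpha> x has_vector_derivative D t) (at t)" if "t > 0" for t
  proof -
    have "((\<lambda>t. 1 / 2 * (\<Sum>k\<in>UNIV. (max 0 (\<bar>x $ k\<bar> - t))\<^sup>2) + \<alpha> * t)
        has_real_derivative D t) (at t)"
      unfolding D_def
      by (rule derivative_eq_intros DERIV_sum has_real_derivative_max_square refl)+ simp
    \<comment> \<open>The closed form is available only for nonnegative \<open>t\<close>; the open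
      half-line supplies the neighbourhood of \<open>t\<close> on which both functions
      agree.\<close>
    then have "(psi \<alpha> x has_real_derivative D t) (at t)"
      by (rule has_field_derivative_transform_within_open[where S = "{0<..}"])
        (use that in \<open>auto simp: psi_eq_sum_max\<close>)
    then show ?thesis by (simp add: has_real_derivative_iff_has_vector_derivative)
  qed
  moreover have "continuous_on {0<..} D"
    unfolding D_def by (intro continuous_intros)
  ultimately show ?thesis
    unfolding C1_differentiable_on_def by auto
qed

lemma continuous_on_psi: "continuous_on {0..} (psi \<alpha> x)"
proof -
  have "continuous_on {0..} (\<lambda>t. 1 / 2 * (\<Sum>k\<in>UNIV. (max 0 (\<bar>x $ k\<bar> - t))\<^sup>2) + \<alpha> * t)"
    by (intro continuous_intros)
  then show ?thesis
    by (rule continuous_on_eq) (simp add: psi_eq_sum_max)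
qed

section \<open>Strict convexity up to the sup norm\<close>

lemma square_convex_comb:
  fixes p q u v :: real
  assumes "u + v = 1"
  shows "(u * p + v * q)\<^sup>2 = u * p\<^sup>2 + v * q\<^sup>2 - u * v * (p - q)\<^sup>2"
proof -
  have v: "v = 1 - u" using assms by simp
  show ?thesis unfolding v by (simp add: power2_eq_square algebra_simps)
qed

text \<open>The truncation \<open>max 0 (c - t)\<close> is convex and nonnegative in
  \<open>t\<close>, and squaring is monotone and convex on nonnegative numbers.\<close>

lemma max_square_convex:
  fixes c a b u v :: real
  assumes "0 < u" "0 < v" "u + v = 1"
  shows "(max 0 (c - (u * a + v * b)))\<^sup>2 \<le> u * (max 0 (c - a))\<^sup>2 + v * (max 0 (c - b))\<^sup>2"
proof -
  have "c - (u * a + v * b) = u * (c - a) + v * (c - b)"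
    using assms(3) by (simp add: algebra_simps flip: distrib_left)
  also have "\<dots> \<le> u * max 0 (c - a) + v * max 0 (c - b)"
    using assms by (intro add_mono mult_left_mono) auto
  finally have "max 0 (c - (u * a + v * b)) \<le> u * max 0 (c - a) + v * max 0 (c - b)"
    using assms by simp
  then have "(max 0 (c - (u * a + v * b)))\<^sup>2 \<le> (u * max 0 (c - a) + v * max 0 (c - b))\<^sup>2"
    by (intro power_mono) auto
  also have "\<dots> \<le> u * (max 0 (c - a))\<^sup>2 + v * (max 0 (c - b))\<^sup>2"
    using assms by (simp add: square_convex_comb)
  finally show ?thesis .
qed

text \<open>With both points at most \<open>c\<close> the truncation is inactive, and the gap in
  \<open>square_convex_comb\<close> becomes \<open>u * v * (a - b)\<^sup>2\<close>, which is
  positive.\<close>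

lemma max_square_strictly_convex:
  fixes c a b u v :: real
  assumes "a \<le> c" "b \<le> c" "a \<noteq> b" "0 < u" "0 < v" "u + v = 1"
  shows "(max 0 (c - (u * a + v * b)))\<^sup>2 < u * (max 0 (c - a))\<^sup>2 + v * (max 0 (c - b))\<^sup>2"
proof -
  have "c - (u * a + v * b) = u * (c - a) + v * (c - b)"
    using assms(6) by (simp add: algebra_simps flip: distrib_left)
  moreover have "0 \<le> u * (c - a) + v * (c - b)"
    using assms by simp
  ultimately show ?thesis
    using assms by (simp add: square_convex_comb)
qed

lemma exists_abs_component_eq_infnorm: "\<exists>k. \<bar>x $ k\<bar> = infnorm (x :: real ^ 'n::finite)"
proof -
  have "Sup (range (\<lambda>k. \<bar>x $ k\<bar>)) \<in> range (\<lambda>k. \<bar>x $ k\<bar>)"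
    by (subst cSup_eq_Max) (auto intro: Max_in)
  then show ?thesis
    by (auto simp: infnorm_cart full_SetCompr_eq)
qed

lemma strictly_convex_on_psi: "strictly_convex_on {0..infnorm x} (psi \<alpha> x)"
  unfolding strictly_convex_on_def
proof (intro conjI ballI allI impI)
  fix a b u v :: real
  assume ab: "a \<in> {0..infnorm x}" "b \<in> {0..infnorm x}" "a \<noteq> b"
    and uv: "0 < u" "0 < v" "u + v = 1"
  obtain j where j: "\<bar>x $ j\<bar> = infnorm x"
    using exists_abs_component_eq_infnorm by blast
  let ?p = "\<lambda>t k. (max 0 (\<bar>x $ k\<bar> - t))\<^sup>2"
  have "(\<Sum>k\<in>UNIV. ?p (u * a + v * b) k) < (\<Sum>k\<in>UNIV. u * ?p a k + v * ?p b k)"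
  proof (rule sum_strict_mono_ex1)
    show "\<forall>k\<in>UNIV. ?p (u * a + v * b) k \<le> u * ?p a k + v * ?p b k"
      using uv by (intro ballI max_square_convex)
    show "\<exists>k\<in>UNIV. ?p (u * a + v * b) k < u * ?p a k + v * ?p b k"
      using ab uv j by (intro bexI[of _ j] max_square_strictly_convex) auto
  qed simp
  moreover have "0 \<le> u * a + v * b"
    using ab uv by simp
  ultimately show "psi \<alpha> x (u *\<^sub>R a + v *\<^sub>R b) < u * psi \<alpha> x a + v * psi \<alpha> x b"
    using ab by (simp add: psi_eq_sum_max sum.distrib algebra_simps flip: sum_distrib_left)
qed simp

section \<open>Existence and location of the smallest minimizer\<close>

lemma psi_beyond_infnorm:
  assumes "infnorm x \<le> t"
  shows "psi \<alpha> x t = \<alpha> * t"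
proof -
  have "t \<ge> 0" using infnorm_pos_le[of x] assms by linarith
  moreover have "max 0 (\<bar>x $ k\<bar> - t) = 0" for k
    using component_le_infnorm_cart[of x k] assms by simp
  ultimately show ?thesis by (simp add: psi_eq_sum_max)
qed

text \<open>The minimizers form a sublevel set, which is closed by continuity and bounded below by
  \<open>c\<close>, so it contains its infimum. Hence "the smallest minimizer" is meaningful as soon
  as any minimizer exists.\<close>

lemma is_smallest_minimizer_exists:
  fixes f :: "real \<Rightarrow> real"
  assumes "continuous_on {c..} f" and "is_arg_min f (\<lambda>t. t \<ge> c) t\<^sub>0"
  shows "\<exists>\<tau>. is_smallest_minimizer f (\<lambda>t. t \<ge> c) \<tau>"
proof -
  define A where "A = {t \<in> {c..}. f t \<le> f t\<^sub>0}"
  have A: "is_arg_min f (\<lambda>t. t \<ge> c) t \<longleftrightarrow> t \<in> A" for t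
    using assms(2) by (auto simp: is_arg_min_linorder A_def intro: order_trans)
  have "closed A"
    unfolding A_def by (intro continuous_on_closed_Collect_le assms continuous_intros closed_atLeast)
  moreover have "A \<noteq> {}" using assms(2) A by blast
  moreover have bdd: "bdd_below A" by (auto simp: A_def intro!: bdd_belowI[of _ c])
  ultimately have "Inf A \<in> A" by (intro closed_contains_Inf)
  then show ?thesis
    using A bdd unfolding is_smallest_minimizer_def by (blast intro: cInf_lower)
qed

lemma smallest_minimizer_le_infnorm:
  assumes "is_smallest_minimizer (psi \<alpha> x) (\<lambda>t. t \<ge> 0) \<tau>"
  shows "\<tau> \<le> infnorm x"
proof (rule ccontr)
  assume less: "\<not> \<tau> \<le> infnorm x"
  have min: "\<And>t. t \<ge> 0 \<Longrightarrow> psi \<alpha> x \<tau> \<le> psi \<alpha> x t"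
    and least: "\<And>t. is_arg_min (psi \<alpha> x) (\<lambda>t. t \<ge> 0) t \<Longrightarrow> \<tau> \<le> t"
    using assms by (auto simp: is_smallest_minimizer_def is_arg_min_linorder)
  note nonneg = infnorm_pos_le[of x]
  have "\<alpha> * \<tau> \<le> \<alpha> * infnorm x"
    using min[OF nonneg] less by (simp add: psi_beyond_infnorm)
  then have "\<alpha> \<le> 0"
    using less by (smt (verit) mult_less_cancel_left_pos)
  \<comment> \<open>The point \<open>\<tau> + 1\<close> stands for any point to the right of
    \<open>\<tau>\<close>: on this linear stretch a negative slope would give it a smaller
    value.\<close>
  moreover have "\<alpha> \<ge> 0"
    using min[of "\<tau> + 1"] less nonneg by (simp add: psi_beyond_infnorm distrib_left)
  ultimately have "psi \<alpha> x (infnorm x) = psi \<alpha> x \<tau>"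
    using less by (simp add: psi_beyond_infnorm)
  then have "is_arg_min (psi \<alpha> x) (\<lambda>t. t \<ge> 0) (infnorm x)"
    using min nonneg by (simp add: is_arg_min_linorder)
  then show False using least less by blast
qed

section \<open>When zero is a minimizer\<close>

lemma psi_lower_bound:
  assumes "t \<ge> 0"
  shows "psi \<alpha> x 0 + (\<alpha> - l1_norm x) * t \<le> psi \<alpha> x t"
proof -
  \<comment> \<open>The left side is the tangent line at \<open>t = 0\<close> of the convex function
    on the right.\<close>
  have bound: "c\<^sup>2 - 2 * (c * t) \<le> (max 0 (c - t))\<^sup>2" if "c \<ge> 0" for c :: real
  proof (cases "c \<le> t")
    case True
    then have "c * c \<le> c * t" "0 \<le> c * t"
      using that assms by (auto intro: mult_left_mono)
    then show ?thesis using True by (simp add: power2_eq_square)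
  next
    case False
    then show ?thesis by (simp add: power2_diff)
  qed
  have "(\<Sum>k\<in>UNIV. \<bar>x $ k\<bar>\<^sup>2 - 2 * (\<bar>x $ k\<bar> * t)) \<le> (\<Sum>k\<in>UNIV. (max 0 (\<bar>x $ k\<bar> - t))\<^sup>2)"
    by (intro sum_mono bound abs_ge_zero)
  then show ?thesis
    using assms
    by (simp add: psi_eq_sum_max l1_norm_def sum_subtractf algebra_simps
        flip: sum_distrib_left)
qed

lemma psi_upper_bound:
  fixes x :: "real ^ 'n::finite"
  assumes "t \<ge> 0"
  shows "psi \<alpha> x t \<le> psi \<alpha> x 0 + (\<alpha> - l1_norm x) * t + real CARD('n) * t\<^sup>2 / 2"
proof -
  have bound: "(max 0 (c - t))\<^sup>2 \<le> c\<^sup>2 - 2 * (c * t) + t\<^sup>2" for c :: real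
  proof -
    have "(max 0 (c - t))\<^sup>2 \<le> (c - t)\<^sup>2" by (auto simp: max_def)
    then show ?thesis by (simp add: power2_diff)
  qed
  have "(\<Sum>k\<in>UNIV. (max 0 (\<bar>x $ k\<bar> - t))\<^sup>2) \<le>
      (\<Sum>k\<in>UNIV. \<bar>x $ k\<bar>\<^sup>2 - 2 * (\<bar>x $ k\<bar> * t) + t\<^sup>2)"
    by (intro sum_mono bound)
  then show ?thesis
    using assms
    by (simp add: psi_eq_sum_max l1_norm_def sum_subtractf sum.distrib algebra_simps
        flip: sum_distrib_left)
qed

lemma zero_is_arg_min_psi_iff:
  fixes x :: "real ^ 'n::finite"
  shows "is_arg_min (psi \<alpha> x) (\<lambda>t. t \<ge> 0) 0 \<longleftrightarrow> l1_norm x \<le> \<alpha>"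
proof
  assume min: "is_arg_min (psi \<alpha> x) (\<lambda>t. t \<ge> 0) 0"
  show "l1_norm x \<le> \<alpha>"
  proof (rule ccontr)
    assume "\<not> l1_norm x \<le> \<alpha>"
    then have d: "l1_norm x - \<alpha> > 0" by simp
    \<comment> \<open>This is the vertex of the parabola in \<open>psi_upper_bound\<close>; there
      the quadratic term cancels exactly half of the linear decrease.\<close>
    define t where "t = (l1_norm x - \<alpha>) / real CARD('n)"
    have t: "t > 0" "real CARD('n) * t = l1_norm x - \<alpha>"
      using d by (auto simp: t_def)
    have "psi \<alpha> x 0 \<le> psi \<alpha> x t"
      using min t by (simp add: is_arg_min_linorder)
    also have "\<dots> \<le> psi \<alpha> x 0 + (\<alpha> - l1_norm x) * t + real CARD('n) * t * t / 2"
      using psi_upper_bound[of t \<alpha> x] t(1) by (simp add: power2_eq_square mult.assoc)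
    also have "\<dots> = psi \<alpha> x 0 - (l1_norm x - \<alpha>) * t / 2"
      unfolding t(2) by (simp add: field_simps)
    finally show False
      using mult_pos_pos[OF d t(1)] by simp
  qed
next
  assume "l1_norm x \<le> \<alpha>"
  then have "psi \<alpha> x 0 \<le> psi \<alpha> x t" if "t \<ge> 0" for t
    using psi_lower_bound[OF that, of \<alpha> x] that by (smt (verit) mult_nonneg_nonneg)
  then show "is_arg_min (psi \<alpha> x) (\<lambda>t. t \<ge> 0) 0"
    by (simp add: is_arg_min_linorder)
qed

text \<open>Since \<open>\<tau>\<close> is nonnegative and below every minimizer, it vanishes
  exactly when \<open>0\<close> is a minimizer.\<close>

lemma zero_smallest_minimizer_iff:
  assumes "is_smallest_minimizer (psi \<alpha> x) (\<lambda>t. t \<ge> 0) \<tau>"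
  shows "\<tau> = 0 \<longleftrightarrow> l1_norm x \<le> \<alpha>"
  using assms zero_is_arg_min_psi_iff[of \<alpha> x]
  by (auto simp: is_smallest_minimizer_def is_arg_min_def intro: antisym)

section \<open>The sup norm as the first sorted modulus\<close>

lemma infnorm_eq_first_sorted:
  fixes x :: "real ^ 'n::finite" and s :: "nat \<Rightarrow> real" and \<pi> :: "nat \<Rightarrow> 'n"
  assumes perm: "bij_betw \<pi> {1..CARD('n)} UNIV"
    and s_perm: "\<And>k. k \<in> {1..CARD('n)} \<Longrightarrow> s k = \<bar>x $ \<pi> k\<bar>"
    and s_decr: "\<And>k. k \<in> {1..<CARD('n)} \<Longrightarrow> s k \<ge> s (k + 1)"
  shows "infnorm x = s 1"
proof (rule antisym)
  have le: "s k \<le> s 1" if "1 \<le> k" "k \<le> CARD('n)" for k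
    using that
  proof (induction k rule: dec_induct)
    case (step k)
    then show ?case using s_decr[of k] by simp
  qed simp
  obtain j where j: "\<bar>x $ j\<bar> = infnorm x"
    using exists_abs_component_eq_infnorm by blast
  \<comment> \<open>Surjectivity of \<open>\<pi>\<close> places the largest modulus somewhere in the
    sorted list, whose entries are all at most \<open>s 1\<close>.\<close>
  obtain k where k: "k \<in> {1..CARD('n)}" "j = \<pi> k"
    using perm by (metis UNIV_I bij_betw_imp_surj_on imageE)
  then show "infnorm x \<le> s 1" using le[of k] s_perm[of k] j by simp
  show "s 1 \<le> infnorm x"
    using s_perm[of 1] component_le_infnorm_cart[of x "\<pi> 1"] by (simp add: Suc_le_eq)
qed

theorem theorem3p1:
  fixes \<alpha> :: real and x :: "real ^ 'n::finite"
    and s :: "nat \<Rightarrow> real" and \<pi> :: "nat \<Rightarrow> 'n"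
  assumes perm: "bij_betw \<pi> {1..CARD('n)} UNIV"
    and s_perm: "\<And>k. k \<in> {1..CARD('n)} \<Longrightarrow> s k = \<bar>x $ \<pi> k\<bar>"
    and s_decr: "\<And>k. k \<in> {1..<CARD('n)} \<Longrightarrow> s k \<ge> s (k + 1)"
    and s_nonneg: "s (CARD('n)) \<ge> 0"
    and s_last: "s (CARD('n) + 1) = 0"
  shows
   "(\<forall>t\<ge>0. psi \<alpha> x t = 1 / 2 * (\<Sum>k\<in>large_idx x t. (\<bar>x $ k\<bar> - t)\<^sup>2) + \<alpha> * t) \<and>
    (infnorm x = s 1) \<and>
    (psi \<alpha> x C1_differentiable_on {0<..}) \<and>
    (strictly_convex_on {0..infnorm x} (psi \<alpha> x)) \<and>
    ((\<exists>t. is_arg_min (psi \<alpha> x) (\<lambda>t. t \<ge> 0) t) \<longrightarrow>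
             (\<exists>\<tau>. is_smallest_minimizer (psi \<alpha> x) (\<lambda>t. t \<ge> 0) \<tau>)) \<and>
    (\<forall>\<tau>. is_smallest_minimizer (psi \<alpha> x) (\<lambda>t. t \<ge> 0) \<tau> \<longrightarrow> \<tau> \<le> infnorm x) \<and>
    (\<forall>\<tau>. is_smallest_minimizer (psi \<alpha> x) (\<lambda>t. t \<ge> 0) \<tau> \<longrightarrow>
             (\<tau> = 0 \<longleftrightarrow> l1_norm x \<le> \<alpha>))"
  using psi_eq_sum_large_idx infnorm_eq_first_sorted[OF perm s_perm s_decr]
    C1_differentiable_on_psi strictly_convex_on_psi
    is_smallest_minimizer_exists[OF continuous_on_psi]
    smallest_minimizer_le_infnorm zero_smallest_minimizer_iff
  by blast

end
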